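(* Let $h(\mu;x)$ be the formal power series $$h(\mu;x)=\sum_{k=0}^\infty h_k\frac{(\mu)_{2k}}{(\mu+1)_k\,k!}x^k .$$ If $\{h_k\}_{k=0}^\infty$ is log-concave (log-convex) and independent of $\mu$, then $\mu\mapsto h(\mu;x)$ is log-concave (log-convex) for integer shifts, i.e. $\Delta_h(\alpha,\beta;x)\ge0$ ($\Delta_h(\alpha,\beta;x)\le0$) for $\alpha,\beta\in\mathbb{N}$, and it is coefficient-wise log-concave (log-convex) for these shifts if furthermore $\alpha+\beta\le4$.
   Context: $\mathbb{N}=\{1,2,\dots\}$; the parameter $\mu$ is non-negative; $(\mu)_n$ is the rising factorial: $(\mu)_0=1$, $(\mu)_n=\mu(\mu+1)\cdots(\mu+n-1)$. A non-negative, nontrivial real sequence $\{h_k\}_{k\ge0}$ is called log-concave if $h_k^2\ge h_{k-1}h_{k+1}$ for all $k\ge1$ and its support is an interval of integers (no internal zeros); it is called log-convex if $h_k^2\le h_{k-1}h_{k+1}$ for all $k\ge1$. The generalized Turánian is $$\Delta_h(\alpha,\beta;x)=h(\mu+\alpha;x)h(\mu+\beta;x)-h(\mu;x)h(\mu+\alpha+\beta;x)=\sum_{k}\delta_kx^k .$$ Log-concavity and log-convexity in $\mu$ are considered for a fixed $x$ in the convergence domain of the series. Coefficient-wise log-concave (log-convex) for shifts $\alpha,\beta$ in a set $S$ means that $\delta_k\ge0$ ($\delta_k\le0$) for all $k$ and all $(\alpha,\beta)\in S$; this is meaningful for formal power series regardless of convergence.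
   Formalization: The inequalities for Δ_h(α,β;x) are stated for x ≥ 0 in the convergence domain; for negative x they can fail, e.g. h = (1,1,1,0,…), μ = α = β = 1 gives Δ = 5x³ + 7x⁴, which is negative for −5/7 < x < 0. *)

theory Defs
  imports "HOL-Analysis.Analysis"
begin

definition nonneg_nontrivial :: "(nat \<Rightarrow> real) \<Rightarrow> bool" where
  "nonneg_nontrivial h \<longleftrightarrow> (\<forall>k. 0 \<le> h k) \<and> (\<exists>k. h k \<noteq> 0)"

definition no_internal_zeros :: "(nat \<Rightarrow> real) \<Rightarrow> bool" where
  "no_internal_zeros h \<longleftrightarrow>
     (\<forall>i j k. i \<le> j \<and> j \<le> k \<and> h i \<noteq> 0 \<and> h k \<noteq> 0 \<longrightarrow> h j \<noteq> 0)"

definition log_concave_seq :: "(nat \<Rightarrow> real) \<Rightarrow> bool" where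
  "log_concave_seq h \<longleftrightarrow> nonneg_nontrivial h \<and> no_internal_zeros h \<and>
     (\<forall>k\<ge>1. h (k - 1) * h (k + 1) \<le> (h k)\<^sup>2)"

definition log_convex_seq :: "(nat \<Rightarrow> real) \<Rightarrow> bool" where
  "log_convex_seq h \<longleftrightarrow> nonneg_nontrivial h \<and>
     (\<forall>k\<ge>1. (h k)\<^sup>2 \<le> h (k - 1) * h (k + 1))"

definition hseries :: "(nat \<Rightarrow> real) \<Rightarrow> real \<Rightarrow> real fps" where
  "hseries h \<mu> =
     Abs_fps (\<lambda>k. h k * (pochhammer \<mu> (2 * k) / (pochhammer (\<mu> + 1) k * fact k)))"

text \<open>The generalized Turanian of a family of power series indexed by a real parameter, as a
  formal power series (its coefficients are the numbers \<open>\<delta>\<^sub>k\<close>) and as a function of a real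
  argument. The latter is meaningful only where the four series involved converge, since
  \<^const>\<open>eval_fps\<close> is unspecified elsewhere.\<close>

definition turanian_fps :: "(real \<Rightarrow> real fps) \<Rightarrow> real \<Rightarrow> real \<Rightarrow> real \<Rightarrow> real fps" where
  "turanian_fps F \<mu> \<alpha> \<beta> = F (\<mu> + \<alpha>) * F (\<mu> + \<beta>) - F \<mu> * F (\<mu> + \<alpha> + \<beta>)"

definition turanian :: "(real \<Rightarrow> real fps) \<Rightarrow> real \<Rightarrow> real \<Rightarrow> real \<Rightarrow> real \<Rightarrow> real" where
  "turanian F \<mu> \<alpha> \<beta> x =
     eval_fps (F (\<mu> + \<alpha>)) x * eval_fps (F (\<mu> + \<beta>)) x
     - eval_fps (F \<mu>) x * eval_fps (F (\<mu> + \<alpha> + \<beta>)) x"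

text \<open>The argument \<open>x\<close> is taken non-negative, as everywhere below: for \<open>x < 0\<close> the sign of the
  Turanian is not determined. With \<open>h = (1, 1, 1, 0, 0, \<dots>)\<close>, \<open>\<mu> = \<alpha> = \<beta> = 1\<close> it equals
  \<open>5 x\<^sup>3 + 7 x\<^sup>4\<close>.\<close>

definition converges_at :: "real fps \<Rightarrow> real \<Rightarrow> bool" where
  "converges_at f x \<longleftrightarrow> summable (\<lambda>k. fps_nth f k * x ^ k)"

definition log_concave_for_shifts ::
    "(real \<Rightarrow> real fps) \<Rightarrow> (real \<times> real) set \<Rightarrow> bool" where
  "log_concave_for_shifts F S \<longleftrightarrow>
     (\<forall>x\<ge>0. \<forall>\<mu>\<ge>0. \<forall>(\<alpha>, \<beta>)\<in>S.
        (\<forall>\<nu>\<in>{\<mu>, \<mu> + \<alpha>, \<mu> + \<beta>, \<mu> + \<alpha> + \<beta>}. converges_at (F \<nu>) x) \<longrightarrow>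
        0 \<le> turanian F \<mu> \<alpha> \<beta> x)"

definition log_convex_for_shifts ::
    "(real \<Rightarrow> real fps) \<Rightarrow> (real \<times> real) set \<Rightarrow> bool" where
  "log_convex_for_shifts F S \<longleftrightarrow>
     (\<forall>x\<ge>0. \<forall>\<mu>\<ge>0. \<forall>(\<alpha>, \<beta>)\<in>S.
        (\<forall>\<nu>\<in>{\<mu>, \<mu> + \<alpha>, \<mu> + \<beta>, \<mu> + \<alpha> + \<beta>}. converges_at (F \<nu>) x) \<longrightarrow>
        turanian F \<mu> \<alpha> \<beta> x \<le> 0)"

definition coeffwise_log_concave_for_shifts ::
    "(real \<Rightarrow> real fps) \<Rightarrow> (real \<times> real) set \<Rightarrow> bool" where
  "coeffwise_log_concave_for_shifts F S \<longleftrightarrow>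
     (\<forall>\<mu>\<ge>0. \<forall>(\<alpha>, \<beta>)\<in>S. \<forall>k. 0 \<le> fps_nth (turanian_fps F \<mu> \<alpha> \<beta>) k)"

definition coeffwise_log_convex_for_shifts ::
    "(real \<Rightarrow> real fps) \<Rightarrow> (real \<times> real) set \<Rightarrow> bool" where
  "coeffwise_log_convex_for_shifts F S \<longleftrightarrow>
     (\<forall>\<mu>\<ge>0. \<forall>(\<alpha>, \<beta>)\<in>S. \<forall>k. fps_nth (turanian_fps F \<mu> \<alpha> \<beta>) k \<le> 0)"

end

(* For h = 1 the series hseries h mu is C(x)^mu, with C the Catalan generating function, so its
   coefficients (the Raney numbers) satisfy an additive convolution identity and its Turanian
   vanishes. Hence the k-th Turanian coefficient for general h is a sum of the weights
   h_j h_(k-j) against terms M_j of total sum zero. After symmetrisation in j <-> k - j, M_j is a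
   positive multiple of a polynomial of degree a + b in p = j (k - j). For a + b <= 4 the
   coefficients of this polynomial change sign only once, from negative to positive, so M_j
   changes sign at most once as j moves towards k / 2, while the weights are monotone in the same
   direction; a Chebyshev-type argument gives the sign of the sum. For arbitrary integer shifts,
   the case a = b = 1 says that n |-> h(mu + n; x) is a log-concave (log-convex) sequence, which
   implies the general inequality. *)
theory Submission
  imports Defs
begin

section \<open>Raney numbers: recurrence, convolution and shifts\<close>

text \<open>For \<mu> > 0 this is \<mu> / (\<mu> + 2k) times the binomial coefficient of \<mu> + 2k
  over k; the form chosen here also gives 1 at \<mu> = 0, k = 0.\<close>

definition raney :: "real \<Rightarrow> nat \<Rightarrow> real" where
  "raney \<mu> k = pochhammer \<mu> (2 * k) / (pochhammer (\<mu> + 1) k * fact k)"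

lemma hseries_nth: "fps_nth (hseries h \<mu>) k = h k * raney \<mu> k"
  by (simp add: hseries_def raney_def)

lemma raney_0 [simp]: "raney \<mu> 0 = 1"
  by (simp add: raney_def)

text \<open>All factors of \<open>pochhammer (\<mu> + 1) (Suc k)\<close> occur in the numerator.
  Cancelling them leaves a polynomial in \<mu>, on which the recurrence can be checked.\<close>

lemma raney_Suc:
  assumes "0 \<le> \<mu>"
  shows "raney \<mu> (Suc k) = \<mu> * pochhammer (\<mu> + real k + 2) k / fact (Suc k)"
proof -
  have "pochhammer \<mu> (2 * Suc k) = \<mu> * pochhammer (\<mu> + 1) (Suc k + k)"
    using pochhammer_rec[of \<mu> "Suc k + k"] by (simp add: mult_2)
  also have "\<dots> = pochhammer (\<mu> + 1) (Suc k) * (\<mu> * pochhammer (\<mu> + real k + 2) k)"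
    by (subst pochhammer_product') (simp add: algebra_simps)
  finally have eq: "pochhammer \<mu> (2 * Suc k) = pochhammer (\<mu> + 1) (Suc k) * (\<mu> * pochhammer (\<mu> + real k + 2) k)" .
  have "pochhammer (\<mu> + 1) (Suc k) > 0"
    using assms by (intro pochhammer_pos) simp
  then show ?thesis
    unfolding raney_def eq by (simp del: fact_Suc)
qed

lemma raney_pos:
  assumes "0 < \<mu>"
  shows "0 < raney \<mu> k"
  using assms by (simp add: raney_def pochhammer_pos)

lemma raney_nonneg:
  assumes "0 \<le> \<mu>"
  shows "0 \<le> raney \<mu> k"
  using assms raney_pos[of \<mu> k] by (cases "\<mu> = 0") (auto simp: raney_def pochhammer_0_left)

text \<open>Coefficient form of C^(\<mu> + 1) = C^\<mu> + x C^(\<mu> + 2), that is, of C = 1 + x C^2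
  multiplied by C^\<mu>.\<close>

lemma raney_rec:
  assumes "0 \<le> \<mu>"
  shows "raney (\<mu> + 1) (Suc k) = raney \<mu> (Suc k) + raney (\<mu> + 2) k"
proof (cases k)
  case 0
  then show ?thesis using assms by (simp add: raney_Suc)
next
  case (Suc n)
  let ?P = "pochhammer (\<mu> + real n + 4) n"
  have 1: "pochhammer (\<mu> + 1 + real k + 2) k = (\<mu> + 2 * real n + 4) * ?P"
    by (simp add: Suc pochhammer_Suc algebra_simps)
  have 2: "pochhammer (\<mu> + real k + 2) k = (\<mu> + real n + 3) * ?P"
    by (simp add: Suc pochhammer_rec algebra_simps)
  \<comment> \<open>The factor \<open>n + 2\<close> lifts the denominator \<open>fact k\<close> to
    \<open>fact (Suc k)\<close>, which the other two terms have already.\<close>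
  have 3: "raney (\<mu> + 2) k = (\<mu> + 2) * ?P * (real n + 2) / fact (Suc k)"
  proof -
    have "fact (Suc k) = (real n + 2) * fact k"
      by (simp add: Suc)
    then show ?thesis
      using assms by (simp add: Suc raney_Suc add_ac del: fact_Suc)
  qed
  have "(\<mu> + 1) * ((\<mu> + 2 * real n + 4) * ?P) = 
     \<mu> * ((\<mu> + real n + 3) * ?P) + (\<mu> + 2) * ?P * (real n + 2)"
    by (simp add: algebra_simps)
  then show ?thesis
    using assms
    by (simp only: raney_Suc 1 2 3 add_nonneg_nonneg zero_le_one add_divide_distrib[symmetric])
qed

text \<open>Coefficient form of C^(\<mu> + 1) C^\<nu> = C^\<mu> C^(\<nu> + 1). On both sides the
  recurrence splits off the same unshifted convolution and leaves one of lower order with a shift by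
  two.\<close>

lemma raney_convolution_shift:
  assumes "0 \<le> \<mu>" "0 \<le> \<nu>"
  shows "(\<Sum>j\<le>k. raney (\<mu> + 1) j * raney \<nu> (k - j)) =
         (\<Sum>j\<le>k. raney \<mu> j * raney (\<nu> + 1) (k - j))"
  using assms
proof (induction k arbitrary: \<mu> \<nu>)
  case 0
  then show ?case by simp
next
  case (Suc k)
  let ?T = "\<lambda>k \<mu> \<nu>. \<Sum>j\<le>k. raney \<mu> j * raney \<nu> (k - j)"
  have left: "?T (Suc k) (\<mu> + 1) \<nu> = ?T (Suc k) \<mu> \<nu> + ?T k (\<mu> + 2) \<nu>"
    using Suc.prems
    by (simp add: sum.atMost_Suc_shift raney_rec distrib_right sum.distrib del: sum.atMost_Suc)
  \<comment> \<open>The term \<open>j = Suc k\<close> is set aside: its second factor has index 0,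
    where the recurrence does not apply.\<close>
  have "?T (Suc k) \<mu> (\<nu> + 1) - raney \<mu> (Suc k) =
      (\<Sum>j\<le>k. raney \<mu> j * raney \<nu> (Suc k - j) + raney \<mu> j * raney (\<nu> + 2) (k - j))"
    using Suc.prems by (simp add: Suc_diff_le raney_rec distrib_left)
  then have right: "?T (Suc k) \<mu> (\<nu> + 1) = ?T (Suc k) \<mu> \<nu> + ?T k \<mu> (\<nu> + 2)"
    by (simp add: sum.distrib)
  \<comment> \<open>The shift by two moves in two unit steps, by way of \<open>\<mu> + 1\<close> and
    \<open>\<nu> + 1\<close>.\<close>
  have "?T k (\<mu> + 2) \<nu> = ?T k \<mu> (\<nu> + 2)"
    using Suc.IH[of "\<mu> + 1" \<nu>] Suc.IH[of \<mu> "\<nu> + 1"] Suc.prems by (simp add: add.assoc)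
  then show ?case using left right by simp
qed

lemma raney_convolution_shift_nat:
  assumes "0 \<le> \<mu>" "0 \<le> \<nu>"
  shows "(\<Sum>j\<le>k. raney (\<mu> + real n) j * raney \<nu> (k - j)) =
         (\<Sum>j\<le>k. raney \<mu> j * raney (\<nu> + real n) (k - j))"
  using assms
proof (induction n arbitrary: \<nu>)
  case 0
  then show ?case by simp
next
  case (Suc n)
  have "(\<Sum>j\<le>k. raney (\<mu> + real (Suc n)) j * raney \<nu> (k - j)) =
        (\<Sum>j\<le>k. raney (\<mu> + real n) j * raney (\<nu> + 1) (k - j))"
    using raney_convolution_shift[of "\<mu> + real n" \<nu> k] Suc.prems by (simp add: add_ac)
  also have "\<dots> = (\<Sum>j\<le>k. raney \<mu> j * raney (\<nu> + real (Suc n)) (k - j))"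
    using Suc.IH[of "\<nu> + 1"] Suc.prems by (simp add: add_ac)
  finally show ?case .
qed

text \<open>By the recurrence, a unit shift adds a non-negative Raney number at every positive
  index.\<close>

lemma raney_mono_nat:
  assumes "0 \<le> \<mu>" "m \<le> n"
  shows "raney (\<mu> + real m) k \<le> raney (\<mu> + real n) k"
  using assms(2)
proof (induction rule: dec_induct)
  case (step n)
  show ?case
  proof (cases k)
    case (Suc i)
    have "raney (\<mu> + real n) k \<le> raney (\<mu> + real n + 1) k"
      using assms(1) raney_rec[of "\<mu> + real n" i] raney_nonneg[of "\<mu> + real n + 2" i] Suc by simp
    then show ?thesis using step.IH by (simp add: add_ac)
  qed simp
qed simp

text \<open>Splitting \<open>pochhammer \<mu> (a + 2 * j)\<close> and
  \<open>pochhammer (\<mu> + 1) (a + j)\<close> in either order turns the ratio of the two Raney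
  numbers into a rational function of \<open>j\<close>.\<close>

lemma raney_shift:
  assumes "0 < \<mu>"
  shows "raney (\<mu> + real a) j * (\<mu> * pochhammer (\<mu> + real j + 1) a) =
         raney \<mu> j * ((\<mu> + real a) * pochhammer (\<mu> + 2 * real j) a)"
proof -
  have 1: "pochhammer \<mu> a * pochhammer (\<mu> + real a) (2 * j) = pochhammer \<mu> (2 * j) * pochhammer (\<mu> + 2 * real j) a"
    using pochhammer_product'[of \<mu> a "2 * j"] pochhammer_product'[of \<mu> "2 * j" a]
    by (simp add: add.commute)
  have 2: "pochhammer (\<mu> + 1) a * pochhammer (\<mu> + real a + 1) j =
     pochhammer (\<mu> + 1) j * pochhammer (\<mu> + real j + 1) a"
    using pochhammer_product'[of "\<mu> + 1" a j] pochhammer_product'[of "\<mu> + 1" j a]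
    by (simp add: add_ac)
  have 3: "\<mu> * pochhammer (\<mu> + 1) a = (\<mu> + real a) * pochhammer \<mu> a"
    using pochhammer_rec[of \<mu> a] pochhammer_rec'[of \<mu> a] by simp
  have pos: "pochhammer \<mu> a > 0" "pochhammer (\<mu> + 1) a > 0" "pochhammer (\<mu> + 1) j > 0"
     "pochhammer (\<mu> + real a + 1) j > 0"
    using assms by (auto intro!: pochhammer_pos)
  have A: "raney (\<mu> + real a) j = pochhammer \<mu> (2 * j) * pochhammer (\<mu> + 2 * real j) a / 
      (pochhammer \<mu> a * pochhammer (\<mu> + real a + 1) j * fact j)"
    unfolding raney_def 1[symmetric] using pos by simp
  have B: "pochhammer (\<mu> + real j + 1) a = pochhammer (\<mu> + 1) a * pochhammer (\<mu> + real a + 1) j / pochhammer (\<mu> + 1) j"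
    unfolding 2 using pos by simp
  have "raney (\<mu> + real a) j * (\<mu> * pochhammer (\<mu> + real j + 1) a) =
     (\<mu> * pochhammer (\<mu> + 1) a) * pochhammer \<mu> (2 * j) * pochhammer (\<mu> + 2 * real j) a / 
      (pochhammer \<mu> a * pochhammer (\<mu> + 1) j * fact j)"
    unfolding A B using pos by (simp add: field_simps)
  also have "\<dots> = raney \<mu> j * ((\<mu> + real a) * pochhammer (\<mu> + 2 * real j) a)"
    unfolding 3 raney_def using pos by (simp add: field_simps)
  finally show ?thesis .
qed

text \<open>Putting the shifts \<open>\<mu>\<close>, \<open>\<mu> + a\<close>, \<open>\<mu> + b\<close>, \<open>\<mu> + a + b\<close> over a common denominator leaves
  this polynomial numerator for the shift \<open>a\<close>.\<close>

definition raney_num :: "real \<Rightarrow> nat \<Rightarrow> nat \<Rightarrow> real \<Rightarrow> real" where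
  "raney_num \<mu> a b x = (\<mu> + real a) * pochhammer (\<mu> + 2 * x) a * pochhammer (\<mu> + x + 1 + real a) b"

lemma raney_num:
  assumes "0 < \<mu>"
  shows "raney (\<mu> + real a) j * (\<mu> * pochhammer (\<mu> + real j + 1) (a + b)) =
         raney \<mu> j * raney_num \<mu> a b (real j)"
  using arg_cong[OF raney_shift[OF assms, of a j], of "\<lambda>t. t * pochhammer (\<mu> + real j + 1 + real a) b"]
  by (simp add: pochhammer_product' raney_num_def mult_ac)

text \<open>The contribution of the index pair (i, l) to the Turanian coefficient of order i + l,
  stripped of its weight \<open>h i * h l\<close>.\<close>

definition turan_term :: "real \<Rightarrow> nat \<Rightarrow> nat \<Rightarrow> nat \<Rightarrow> nat \<Rightarrow> real" where
  "turan_term \<mu> a b i l = raney (\<mu> + real a) i * raney (\<mu> + real b) l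
     - raney \<mu> i * raney (\<mu> + real a + real b) l"

definition turan_poly :: "real \<Rightarrow> nat \<Rightarrow> nat \<Rightarrow> real \<Rightarrow> real \<Rightarrow> real" where
  "turan_poly \<mu> a b x y = raney_num \<mu> a b x * raney_num \<mu> b a y - raney_num \<mu> 0 (a + b) x * raney_num \<mu> (a + b) 0 y"

text \<open>Both multipliers are positive and symmetric in \<open>i\<close> and \<open>l\<close>, so
  the sign of a symmetrised term is that of the symmetrised polynomial.\<close>

lemma turan_term_poly:
  assumes "0 < \<mu>"
  shows "turan_term \<mu> a b i l * (\<mu>\<^sup>2 * pochhammer (\<mu> + real i + 1) (a + b) * pochhammer (\<mu> + real l + 1) (a + b)) =
         raney \<mu> i * raney \<mu> l * turan_poly \<mu> a b (real i) (real l)"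
proof -
  note n = raney_num[OF assms]
  have 1: "raney (\<mu> + real a) i * (\<mu> * pochhammer (\<mu> + real i + 1) (a + b)) *
      (raney (\<mu> + real b) l * (\<mu> * pochhammer (\<mu> + real l + 1) (a + b))) =
      raney \<mu> i * raney_num \<mu> a b (real i) * (raney \<mu> l * raney_num \<mu> b a (real l))"
    using n[of a i b] n[of b l a] by (simp add: add.commute)
  have 2: "raney \<mu> i * (\<mu> * pochhammer (\<mu> + real i + 1) (a + b)) *
      (raney (\<mu> + real a + real b) l * (\<mu> * pochhammer (\<mu> + real l + 1) (a + b))) =
      raney \<mu> i * raney_num \<mu> 0 (a + b) (real i) * (raney \<mu> l * raney_num \<mu> (a + b) 0 (real l))"
    using n[of 0 i "a + b"] n[of "a + b" l 0] by (simp add: add.assoc)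
  show ?thesis
    unfolding turan_term_def turan_poly_def left_diff_distrib right_diff_distrib power2_eq_square
    using 1 2 by (simp add: mult_ac)
qed

section \<open>Single sign changes and weighted sums\<close>

text \<open>The coefficients change sign at most once, at a1 or later. Dividing by p if
  \<open>a2\<close> is non-negative, and by p^2 otherwise, makes every term of the quotient
  non-decreasing in p > 0.\<close>

lemma quartic_sign:
  fixes p q :: real
  assumes a: "a0 \<le> 0" "a2 < 0 \<Longrightarrow> a1 \<le> 0" "0 \<le> a3" "0 \<le> a4"
    and pq: "0 \<le> p" "p \<le> q"
    and pos: "0 < a0 + a1 * p + a2 * p^2 + a3 * p^3 + a4 * p^4"
  shows "0 \<le> a0 + a1 * q + a2 * q^2 + a3 * q^3 + a4 * q^4"
proof -
  let ?F = "\<lambda>p. a0 + a1 * p + a2 * p^2 + a3 * p^3 + a4 * p^4"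
  have "p \<noteq> 0" using pos a(1) by auto
  then have p: "0 < p" and q: "0 < q" using pq by auto
  have d: "0 \<le> q - p" "0 \<le> q^2 - p^2" "0 \<le> q^3 - p^3"
    using pq by (auto intro: power_mono)
  show ?thesis
  proof (cases "a2 < 0")
    case False
    \<comment> \<open>This is p q (F(q)/q - F(p)/p), cleared of denominators; the \<open>a1\<close>
      terms cancel.\<close>
    have "p * ?F q - q * ?F p = (- a0) * (q - p) + a2 * (p * q * (q - p))
        + a3 * (p * q * (q^2 - p^2)) + a4 * (p * q * (q^3 - p^3))"
      by algebra
    also have "\<dots> \<ge> 0"
      using a p q d False by (intro add_nonneg_nonneg mult_nonneg_nonneg) auto
    finally have "0 \<le> p * ?F q" using mult_pos_pos[OF q pos] by linarith
    then show ?thesis using p by (simp add: zero_le_mult_iff)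
  next
    case True
    have "p^2 * ?F q - q^2 * ?F p = (- a0) * (q^2 - p^2) + (- a1) * (p * q * (q - p))
        + a3 * (p^2 * q^2 * (q - p)) + a4 * (p^2 * q^2 * (q^2 - p^2))"
      by algebra
    also have "\<dots> \<ge> 0"
      using a p q d True by (intro add_nonneg_nonneg mult_nonneg_nonneg) auto
    finally have "0 \<le> p^2 * ?F q" using mult_pos_pos[OF _ pos, of "q^2"] q by auto
    then show ?thesis using p by (simp add: zero_le_mult_iff)
  qed
qed

text \<open>Since \<open>M\<close> sums to zero, all weights may be lowered by \<open>w i\<close>,
  where \<open>i\<close> has the least key among the elements with \<open>0 < M i\<close>. Beyond
  that key neither factor of \<open>(w j - w i) * M j\<close> is negative, before it neither is
  positive.\<close>

lemma sum_weighted_nonneg: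
  fixes M w :: "'a \<Rightarrow> real" and key :: "'a \<Rightarrow> nat"
  assumes fin: "finite A" and sum: "sum M A = 0"
    and sign: "\<And>i j. \<lbrakk>i \<in> A; j \<in> A; key i \<le> key j; 0 < M i\<rbrakk> \<Longrightarrow> 0 \<le> M j"
    and mono: "\<And>i j. \<lbrakk>i \<in> A; j \<in> A; key i \<le> key j\<rbrakk> \<Longrightarrow> w i \<le> w j"
  shows "0 \<le> (\<Sum>j\<in>A. w j * M j)"
proof (cases "\<exists>i\<in>A. 0 < M i")
  case True
  then obtain i where i: "i \<in> A" "0 < M i"
      and min: "\<And>j. j \<in> A \<Longrightarrow> 0 < M j \<Longrightarrow> key i \<le> key j"
    using ex_has_least_nat[of "\<lambda>i. i \<in> A \<and> 0 < M i" _ key] by blast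
  have "0 \<le> (w j - w i) * M j" if j: "j \<in> A" for j
  proof (cases "0 < M j")
    case True
    then show ?thesis using mono[OF i(1) j min[OF j]] by simp
  next
    case False
    show ?thesis
    proof (cases "key i \<le> key j")
      case True
      then have "M j = 0" using sign[OF i(1) j _ i(2)] False by simp
      then show ?thesis by simp
    next
      case notle: False
      then have "w j \<le> w i" using mono[OF j i(1)] by simp
      then show ?thesis using False by (intro mult_nonpos_nonpos) auto
    qed
  qed
  then have "0 \<le> (\<Sum>j\<in>A. (w j - w i) * M j)" by (rule sum_nonneg)
  also have "\<dots> = (\<Sum>j\<in>A. w j * M j) - w i * sum M A"
    by (simp add: left_diff_distrib sum_subtractf sum_distrib_left)
  finally show ?thesis using sum by simp
next
  case False
  then have "\<forall>j\<in>A. 0 \<le> - M j" by force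
  then have "\<forall>j\<in>A. M j = 0"
    using sum fin sum_nonneg_eq_0_iff[of A "\<lambda>j. - M j"] by (simp add: sum_negf)
  then show ?thesis by simp
qed

section \<open>Sign patterns of the symmetrised numerators for a + b \<le> 4\<close>

text \<open>In the following four lemmas the values of \<open>a0\<close>, \<dots>, \<open>a4\<close> result from expanding the
  symmetric polynomial in \<open>s = x + y\<close> and \<open>x * y\<close>.\<close>

lemma turan_poly_1_1_sign:
  fixes \<mu> s :: real
  assumes "0 \<le> \<mu>" "0 \<le> s" "0 \<le> s * (s - 1)"
  obtains a0 a1 a2 a3 a4 :: real where "a0 \<le> 0" "a2 < 0 \<Longrightarrow> a1 \<le> 0"
    "0 \<le> a3" "0 \<le> a4"
    "\<And>x y. x + y = s \<Longrightarrow> turan_poly \<mu> 1 1 x y + turan_poly \<mu> 1 1 y x =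
       a0 + a1 * (x * y) + a2 * (x * y)^2 + a3 * (x * y)^3 + a4 * (x * y)^4"
proof -
  \<comment> \<open>The constant term is the value at x * y = 0. Its sign rests on
    \<open>0 \<le> s * (s - 1)\<close>, which every natural number \<open>s\<close>
    satisfies.\<close>
  define a0 :: real where "a0 = - ((s * (s - 1)) * \<mu> * (\<mu> + 1) * (\<mu> + 2) * (\<mu> + 4))"
  define a1 :: real where "a1 = 2 * ((\<mu>^2 + 8 * \<mu> + 8) * s + 2 * \<mu>^4 + 17 *
      \<mu>^3 + 49 * \<mu>^2 + 52 * \<mu> + 16)"
  define a2 :: real where "a2 = 8"
  define a3 :: real where "a3 = 0"
  define a4 :: real where "a4 = 0"
  show thesis
  proof
    have "0 \<le> - a0"
      unfolding a0_def minus_minus using assms by simp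
    then show "a0 \<le> 0" by simp
    have "0 \<le> a2"
      unfolding a2_def using assms by simp
    then show "a1 \<le> 0" if "a2 < 0"
      using that by simp
    show "0 \<le> a3" "0 \<le> a4"
      unfolding a3_def a4_def using assms by simp_all
    show "turan_poly \<mu> 1 1 x y + turan_poly \<mu> 1 1 y x =
       a0 + a1 * (x * y) + a2 * (x * y)^2 + a3 * (x * y)^3 + a4 * (x * y)^4" if "x + y = s" for x y
      unfolding a0_def a1_def a2_def a3_def a4_def that[symmetric]
      \<comment> \<open>The first call multiplies out the Pochhammer symbols, reading numerals as
        successors; the second restores the numerals, leaving a polynomial identity for
        \<open>algebra\<close>.\<close>
      by (simp add: turan_poly_def raney_num_def numeral_eq_Suc pochhammer_rec,
          simp add: add.assoc power_numeral_reduce flip: numeral_eq_Suc, algebra)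
  qed
qed

lemma turan_poly_1_2_sign:
  fixes \<mu> s :: real
  assumes "0 \<le> \<mu>" "0 \<le> s" "0 \<le> s * (s - 1)"
  obtains a0 a1 a2 a3 a4 :: real where "a0 \<le> 0" "a2 < 0 \<Longrightarrow> a1 \<le> 0"
    "0 \<le> a3" "0 \<le> a4"
    "\<And>x y. x + y = s \<Longrightarrow> turan_poly \<mu> 1 2 x y + turan_poly \<mu> 1 2 y x =
       a0 + a1 * (x * y) + a2 * (x * y)^2 + a3 * (x * y)^3 + a4 * (x * y)^4"
proof -
  define a0 :: real where "a0 = - ((s * (s - 1)) * \<mu> * (\<mu> + 1) * (\<mu> + 2) *
      (\<mu> + 3) * ((3 * \<mu> + 14) * s + 2 * \<mu>^2 + 12 * \<mu> + 12))"
  define a1 :: real where "a1 = 2 * ((-2 * \<mu>^4 - 15 * \<mu>^3 - 17 * \<mu>^2 + 42 *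
      \<mu> + 60) * s^2 + (6 * \<mu>^5 + 77 * \<mu>^4 + 369 * \<mu>^3 + 784 * \<mu>^2 + 720 *
      \<mu> + 228) * s + 4 * \<mu>^6 + 54 * \<mu>^5 + 282 * \<mu>^4 + 720 * \<mu>^3 + 948 *
      \<mu>^2 + 612 * \<mu> + 144)"
  define a2 :: real where "a2 = 8 * ((\<mu>^2 + 12 * \<mu> + 17) * s + 2 * \<mu>^4 + 21 *
      \<mu>^3 + 77 * \<mu>^2 + 105 * \<mu> + 40)"
  define a3 :: real where "a3 = 32"
  define a4 :: real where "a4 = 0"
  show thesis
  proof
    have "0 \<le> - a0"
      unfolding a0_def minus_minus using assms by simp
    then show "a0 \<le> 0" by simp
    \<comment> \<open>For large \<mu> the sign of \<open>a1\<close> varies with \<open>s\<close>; as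
      \<open>a2\<close> is non-negative, there is still only one sign change.\<close>
    have "0 \<le> a2"
      unfolding a2_def using assms by simp
    then show "a1 \<le> 0" if "a2 < 0"
      using that by simp
    show "0 \<le> a3" "0 \<le> a4"
      unfolding a3_def a4_def using assms by simp_all
    show "turan_poly \<mu> 1 2 x y + turan_poly \<mu> 1 2 y x =
       a0 + a1 * (x * y) + a2 * (x * y)^2 + a3 * (x * y)^3 + a4 * (x * y)^4" if "x + y = s" for x y
      unfolding a0_def a1_def a2_def a3_def a4_def that[symmetric]
      by (simp add: turan_poly_def raney_num_def numeral_eq_Suc pochhammer_rec,
          simp add: add.assoc power_numeral_reduce flip: numeral_eq_Suc, algebra)
  qed
qed

lemma turan_poly_2_2_sign:
  fixes \<mu> s :: real
  assumes "0 \<le> \<mu>" "0 \<le> s" "0 \<le> s * (s - 1)"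
  obtains a0 a1 a2 a3 a4 :: real where "a0 \<le> 0" "a2 < 0 \<Longrightarrow> a1 \<le> 0"
    "0 \<le> a3" "0 \<le> a4"
    "\<And>x y. x + y = s \<Longrightarrow> turan_poly \<mu> 2 2 x y + turan_poly \<mu> 2 2 y x =
       a0 + a1 * (x * y) + a2 * (x * y)^2 + a3 * (x * y)^3 + a4 * (x * y)^4"
proof -
  define a0 :: real where "a0 = - ((s * (s - 1)) * \<mu> * (\<mu> + 1) * (\<mu> + 2) *
      (\<mu> + 3) * (\<mu> + 4) * ((9 * \<mu> + 48) * s^2 + (12 * \<mu>^2 + 87 * \<mu> + 120) *
      s + 4 * \<mu>^3 + 36 * \<mu>^2 + 86 * \<mu> + 48))"
  define a1 :: real where "a1 = 4 * ((-6 * \<mu>^5 - 75 * \<mu>^4 - 309 * \<mu>^3 - 455 *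
      \<mu>^2 - 68 * \<mu> + 192) * s^3 + (5 * \<mu>^6 + 102 * \<mu>^5 + 804 * \<mu>^4 + 3023 *
      \<mu>^3 + 5610 * \<mu>^2 + 4788 * \<mu> + 1440) * s^2 + (12 * \<mu>^7 + 231 * \<mu>^6 +
      1806 * \<mu>^5 + 7356 * \<mu>^4 + 16719 * \<mu>^3 + 20975 * \<mu>^2 + 13136 * \<mu> +
      2976) * s + 4 * \<mu>^8 + 82 * \<mu>^7 + 696 * \<mu>^6 + 3172 * \<mu>^5 + 8429 * \<mu>^4 +
      13265 * \<mu>^3 + 11986 * \<mu>^2 + 5712 * \<mu> + 1152)"
  define a2 :: real where "a2 = 4 * ((-4 * \<mu>^4 - 32 * \<mu>^3 + 13 * \<mu>^2 + 380 *
      \<mu> + 496) * s^2 + (24 * \<mu>^5 + 366 * \<mu>^4 + 2130 * \<mu>^3 + 5701 * \<mu>^2 +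
      6952 * \<mu> + 3144) * s + 16 * \<mu>^6 + 270 * \<mu>^5 + 1825 * \<mu>^4 + 6321 * \<mu>^3
      + 11970 * \<mu>^2 + 11888 * \<mu> + 4808)"
  define a3 :: real where "a3 = 32 * ((\<mu>^2 + 16 * \<mu> + 30) * s + 2 * \<mu>^4 + 25 *
      \<mu>^3 + 111 * \<mu>^2 + 190 * \<mu> + 101)"
  define a4 :: real where "a4 = 128"
  show thesis
  proof
    have "0 \<le> - a0"
      unfolding a0_def minus_minus using assms by simp
    then show "a0 \<le> 0" by simp
    \<comment> \<open>The multiplier \<open>c\<close> is chosen so that \<open>c * a2 - 4 * a1\<close> has only non-negative
      coefficients; hence \<open>a1\<close> cannot be positive when \<open>a2\<close> is negative.\<close>
    define c where "c = ((4 * \<mu> + 2) * s + \<mu>^2 + 4 * \<mu> + 4)"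
    have "0 \<le> c"
      unfolding c_def using assms by simp
    have "c * a2 - 4 * a1 = 4 * ((8 * \<mu>^5 + 164 * \<mu>^4 + 1224 * \<mu>^3 + 3366 *
        \<mu>^2 + 3016 * \<mu> + 224) * s^3 + (72 * \<mu>^6 + 1056 * \<mu>^5 + 5905 * \<mu>^4 +
        15276 * \<mu>^3 + 18838 * \<mu>^2 + 10832 * \<mu> + 2512) * s^2 + (40 * \<mu>^7 + 650 *
        \<mu>^6 + 4306 * \<mu>^5 + 15195 * \<mu>^4 + 31922 * \<mu>^3 + 41348 * \<mu>^2 + 30848 *
        \<mu> + 10288) * s + 6 * \<mu>^7 + 185 * \<mu>^6 + 2013 * \<mu>^5 + 10838 * \<mu>^4 +
        31992 * \<mu>^3 + 52296 * \<mu>^2 + 43936 * \<mu> + 14624)"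
      unfolding c_def a1_def a2_def by algebra
    also have "\<dots> \<ge> 0"
      using assms by simp
    finally show "a1 \<le> 0" if "a2 < 0"
      using that mult_nonneg_nonpos[OF \<open>0 \<le> c\<close>, of a2] by linarith
    show "0 \<le> a3" "0 \<le> a4"
      unfolding a3_def a4_def using assms by simp_all
    show "turan_poly \<mu> 2 2 x y + turan_poly \<mu> 2 2 y x =
       a0 + a1 * (x * y) + a2 * (x * y)^2 + a3 * (x * y)^3 + a4 * (x * y)^4" if "x + y = s" for x y
      unfolding a0_def a1_def a2_def a3_def a4_def that[symmetric]
      by (simp add: turan_poly_def raney_num_def numeral_eq_Suc pochhammer_rec,
          simp add: add.assoc power_numeral_reduce flip: numeral_eq_Suc, algebra)
  qed
qed

lemma turan_poly_1_3_sign: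
  fixes \<mu> s :: real
  assumes "0 \<le> \<mu>" "0 \<le> s" "0 \<le> s * (s - 1)"
  obtains a0 a1 a2 a3 a4 :: real where "a0 \<le> 0" "a2 < 0 \<Longrightarrow> a1 \<le> 0"
    "0 \<le> a3" "0 \<le> a4"
    "\<And>x y. x + y = s \<Longrightarrow> turan_poly \<mu> 1 3 x y + turan_poly \<mu> 1 3 y x =
       a0 + a1 * (x * y) + a2 * (x * y)^2 + a3 * (x * y)^3 + a4 * (x * y)^4"
proof -
  define a0 :: real where "a0 = - ((s * (s - 1)) * \<mu> * (\<mu> + 1) * (\<mu> + 2) *
      (\<mu> + 3) * (\<mu> + 4) * ((7 * \<mu> + 38) * s^2 + (9 * \<mu>^2 + 64 * \<mu> + 80) * s
      + 3 * \<mu>^3 + 27 * \<mu>^2 + 66 * \<mu> + 48))"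
  define a1 :: real where "a1 = ((-18 * \<mu>^5 - 222 * \<mu>^4 - 870 * \<mu>^3 - 1026 *
      \<mu>^2 + 612 * \<mu> + 1248) * s^3 + (17 * \<mu>^6 + 351 * \<mu>^5 + 2807 * \<mu>^4 +
      10797 * \<mu>^3 + 20936 * \<mu>^2 + 19596 * \<mu> + 7200) * s^2 + (36 * \<mu>^7 + 687 *
      \<mu>^6 + 5301 * \<mu>^5 + 21243 * \<mu>^4 + 47619 * \<mu>^3 + 59814 * \<mu>^2 + 38976 *
      \<mu> + 9984) * s + 12 * \<mu>^8 + 246 * \<mu>^7 + 2096 * \<mu>^6 + 9678 * \<mu>^5 + 26516
      * \<mu>^4 + 44196 * \<mu>^3 + 43592 * \<mu>^2 + 22848 * \<mu> + 4608)"
  define a2 :: real where "a2 = 2 * ((-6 * \<mu>^4 - 48 * \<mu>^3 + 24 * \<mu>^2 + 588 *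
      \<mu> + 780) * s^2 + (36 * \<mu>^5 + 543 * \<mu>^4 + 3072 * \<mu>^3 + 7725 * \<mu>^2 +
      8310 * \<mu> + 2964) * s + 22 * \<mu>^6 + 351 * \<mu>^5 + 2158 * \<mu>^4 + 6381 * \<mu>^3
      + 9340 * \<mu>^2 + 6048 * \<mu> + 912)"
  define a3 :: real where "a3 = 24 * ((\<mu>^2 + 16 * \<mu> + 29) * s + 2 * \<mu>^4 + 25 *
      \<mu>^3 + 109 * \<mu>^2 + 173 * \<mu> + 68)"
  define a4 :: real where "a4 = 96"
  show thesis
  proof
    have "0 \<le> - a0"
      unfolding a0_def minus_minus using assms by simp
    then show "a0 \<le> 0" by simp
    \<comment> \<open>Same device as for shifts 2 and 2: with \<open>c * a2 - 2 * a1\<close>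
      non-negative, \<open>a2 < 0\<close> forces \<open>a1 \<le> 0\<close>.\<close>
    define c where "c = ((2 * \<mu> + 2) * s + \<mu>^2 + 6 * \<mu> + 6)"
    have "0 \<le> c"
      unfolding c_def using assms by simp
    have "c * a2 - 2 * a1 = 2 * ((6 * \<mu>^5 + 114 * \<mu>^4 + 822 * \<mu>^3 + 2250 *
        \<mu>^2 + 2124 * \<mu> + 312) * s^3 + (49 * \<mu>^6 + 723 * \<mu>^5 + 4123 * \<mu>^4 +
        11241 * \<mu>^3 + 15586 * \<mu>^2 + 11160 * \<mu> + 3408) * s^2 + (44 * \<mu>^7 + 818 *
        \<mu>^6 + 6263 * \<mu>^5 + 25250 * \<mu>^4 + 56915 * \<mu>^3 + 70136 * \<mu>^2 + 42588 *
        \<mu> + 9624) * s + 10 * \<mu>^8 + 237 * \<mu>^7 + 2300 * \<mu>^6 + 11757 * \<mu>^5 +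
        34058 * \<mu>^4 + 56178 * \<mu>^3 + 49648 * \<mu>^2 + 18912 * \<mu> + 864)"
      unfolding c_def a1_def a2_def by algebra
    also have "\<dots> \<ge> 0"
      using assms by simp
    finally show "a1 \<le> 0" if "a2 < 0"
      using that mult_nonneg_nonpos[OF \<open>0 \<le> c\<close>, of a2] by linarith
    show "0 \<le> a3" "0 \<le> a4"
      unfolding a3_def a4_def using assms by simp_all
    show "turan_poly \<mu> 1 3 x y + turan_poly \<mu> 1 3 y x =
       a0 + a1 * (x * y) + a2 * (x * y)^2 + a3 * (x * y)^3 + a4 * (x * y)^4" if "x + y = s" for x y
      unfolding a0_def a1_def a2_def a3_def a4_def that[symmetric]
      by (simp add: turan_poly_def raney_num_def numeral_eq_Suc pochhammer_rec,
          simp add: add.assoc power_numeral_reduce flip: numeral_eq_Suc, algebra)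
  qed
qed

lemma turan_poly_sign_pattern:
  fixes \<mu> s :: real
  assumes "0 \<le> \<mu>" "0 \<le> s" "0 \<le> s * (s - 1)" and ab: "1 \<le> a" "a \<le> b" "a + b \<le> 4"
  obtains a0 a1 a2 a3 a4 :: real where "a0 \<le> 0" "a2 < 0 \<Longrightarrow> a1 \<le> 0" "0 \<le> a3" "0 \<le> a4"
    "\<And>x y. x + y = s \<Longrightarrow> turan_poly \<mu> a b x y + turan_poly \<mu> a b y x =
       a0 + a1 * (x * y) + a2 * (x * y)^2 + a3 * (x * y)^3 + a4 * (x * y)^4"
proof -
  consider "a = 1" "b = 1" | "a = 1" "b = 2" | "a = 2" "b = 2" | "a = 1" "b = 3"
    using ab by linarith
  then show thesis
  proof cases
    case 1
    show thesis
      by (rule turan_poly_1_1_sign[OF assms(1-3)]) (rule that[unfolded 1]; simp)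
  next
    case 2
    show thesis
      by (rule turan_poly_1_2_sign[OF assms(1-3)]) (rule that[unfolded 2]; simp)
  next
    case 3
    show thesis
      by (rule turan_poly_2_2_sign[OF assms(1-3)]) (rule that[unfolded 3]; simp)
  next
    case 4
    show thesis
      by (rule turan_poly_1_3_sign[OF assms(1-3)]) (rule that[unfolded 4]; simp)
  qed
qed

text \<open>Pairs with equal sum share the coefficients a0, ..., a4, so \<open>quartic_sign\<close>
  applies with the two products as arguments. Strict positivity of \<mu> makes the Raney numbers
  positive, so signs pass between terms and polynomials.\<close>

lemma turan_term_sign:
  assumes "0 < \<mu>" and ab: "1 \<le> a" "a \<le> b" "a + b \<le> 4"
    and il: "i + l = i' + l'" "i * l \<le> i' * l'"
    and pos: "0 < turan_term \<mu> a b i l + turan_term \<mu> a b l i"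
  shows "0 \<le> turan_term \<mu> a b i' l' + turan_term \<mu> a b l' i'"
proof -
  define s where "s = real (i + l)"
  have s: "0 \<le> s" "0 \<le> s * (s - 1)"
    unfolding s_def by (cases "i + l"; simp)+
  obtain a0 a1 a2 a3 a4 :: real where c: "a0 \<le> 0" "a2 < 0 \<Longrightarrow> a1 \<le> 0" "0 \<le> a3" "0 \<le> a4"
    and eq: "\<And>x y. x + y = s \<Longrightarrow> turan_poly \<mu> a b x y + turan_poly \<mu> a b y x =
       a0 + a1 * (x * y) + a2 * (x * y)^2 + a3 * (x * y)^3 + a4 * (x * y)^4"
    by (rule turan_poly_sign_pattern[OF less_imp_le[OF \<open>0 < \<mu>\<close>] s ab]) (rule that; simp)
  define D where "D i l = \<mu>\<^sup>2 * pochhammer (\<mu> + real i + 1) (a + b) * pochhammer (\<mu> + real l + 1) (a + b)" for i l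
  define Q where "Q i l = turan_poly \<mu> a b (real i) (real l) + turan_poly \<mu> a b (real l) (real i)" for i l
  have scale: "(turan_term \<mu> a b i l + turan_term \<mu> a b l i) * D i l = raney \<mu> i * raney \<mu> l * Q i l" for i l
    using turan_term_poly[OF \<open>0 < \<mu>\<close>, of a b i l] turan_term_poly[OF \<open>0 < \<mu>\<close>, of a b l i]
    by (simp add: D_def Q_def algebra_simps)
  have D: "0 < D i l" and R: "0 < raney \<mu> i * raney \<mu> l" for i l
    using \<open>0 < \<mu>\<close> by (auto simp: D_def intro!: mult_pos_pos pochhammer_pos raney_pos)
  have "0 < Q i l"
    using mult_pos_pos[OF pos D[of i l]] unfolding scale by (rule zero_less_mult_pos) (rule R)
  moreover have "Q i l = a0 + a1 * (i * l) + a2 * (i * l)^2 + a3 * (i * l)^3 + a4 * (i * l)^4"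
    using eq[of "real i" "real l"] by (simp add: Q_def s_def)
  moreover have "Q i' l' = a0 + a1 * (i' * l') + a2 * (i' * l')^2 + a3 * (i' * l')^3 + a4 * (i' * l')^4"
    using eq[of "real i'" "real l'"] il(1) by (simp add: Q_def s_def flip: of_nat_add)
  ultimately have "0 \<le> Q i' l'"
    using quartic_sign[OF c, where p = "real (i * l)" and q = "real (i' * l')"] il(2)
    by (simp del: of_nat_mult)
  then have "0 \<le> (turan_term \<mu> a b i' l' + turan_term \<mu> a b l' i') * D i' l'"
    unfolding scale using R[of i' l'] by simp
  then show ?thesis
    using D[of i' l'] by (simp add: zero_le_mult_iff)
qed

section \<open>Signs of the Turanian coefficients\<close>

text \<open>Coefficient form of C^(\<mu> + a) C^(\<mu> + b) = C^\<mu> C^(\<mu> + a + b).\<close>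

lemma sum_turan_term:
  assumes "0 \<le> \<mu>"
  shows "(\<Sum>j\<le>k. turan_term \<mu> a b j (k - j)) = 0"
  using raney_convolution_shift_nat[of \<mu> "\<mu> + real b" a k] assms
  by (simp add: turan_term_def sum_subtractf add_ac)

lemma isCont_raney:
  assumes "0 \<le> \<mu>"
  shows "isCont (\<lambda>\<mu>. raney (\<mu> + real a) k) \<mu>"
proof -
  have "pochhammer (\<mu> + real a + 1) k > 0"
    using assms by (intro pochhammer_pos) simp
  then show ?thesis
    unfolding raney_def by (intro continuous_intros isCont_o2[OF _ isCont_pochhammer]) auto
qed

lemma sum_reflect: "(\<Sum>j\<le>k. f (k - j)) = (\<Sum>j\<le>(k::nat). f j)"
  by (rule sum.reindex_bij_witness[of _ "\<lambda>j. k - j" "\<lambda>j. k - j"]) auto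

text \<open>As \<open>w\<close> is symmetric, symmetrising the terms merely doubles the sum, and
  then the Chebyshev-type lemma applies. The value \<mu> = 0 is reached by continuity.\<close>

lemma sum_weighted_turan_term_nonneg:
  assumes "0 \<le> \<mu>" and ab: "1 \<le> a" "a \<le> b" "a + b \<le> 4"
    and sym: "\<And>j. j \<le> k \<Longrightarrow> w (k - j) = w j"
    and mono: "\<And>j. 2 * j < k \<Longrightarrow> w j \<le> w (Suc j)"
  shows "0 \<le> (\<Sum>j\<le>k. w j * turan_term \<mu> a b j (k - j))"
proof -
  define G where "G \<mu> = (\<Sum>j\<le>k. w j * turan_term \<mu> a b j (k - j))" for \<mu>
  have pos: "0 \<le> G \<mu>" if "0 < \<mu>" for \<mu>
  proof -
    define M where "M j = turan_term \<mu> a b j (k - j) + turan_term \<mu> a b (k - j) j" for j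
    have half: "w i \<le> w j" if "i \<le> j" "2 * j \<le> k" for i j
      using that
    proof (induction rule: dec_induct)
      case (step n)
      then show ?case using mono[of n] by simp
    qed simp
    have "0 \<le> (\<Sum>j\<le>k. w j * M j)"
    \<comment> \<open>The key is the distance to the nearer end of the index range; both
      \<open>w j\<close> and \<open>j * (k - j)\<close> increase with it.\<close>
    proof (rule sum_weighted_nonneg[where key = "\<lambda>j. min j (k - j)"])
      show "sum M {..k} = 0"
        using sum_turan_term[where k = k and a = a and b = b, of \<mu>] sum_reflect[of "\<lambda>j. turan_term \<mu> a b j (k - j)" k] that
        by (simp add: M_def sum.distrib)
    next
      fix i j assume ij: "i \<in> {..k}" "j \<in> {..k}" "min i (k - i) \<le> min j (k - j)"
      have wmin: "w (min n (k - n)) = w n" if "n \<le> k" for n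
        using sym[OF that] by (simp add: min_def)
      have le: "2 * min j (k - j) \<le> k" by linarith
      from half[OF ij(3) this] show "w i \<le> w j"
        using ij(1,2) by (simp add: wmin)
      have minmax: "n * (k - n) = min n (k - n) * (k - min n (k - n))" if "n \<le> k" for n
        using that by (simp add: min_def)
      \<comment> \<open>With v = u + d and k = 2v + e the difference of the two sides is d (d + e),
        and no truncated subtraction remains.\<close>
      have "u * (k - u) \<le> v * (k - v)" if uv: "u \<le> v" "2 * v \<le> k" for u v
      proof -
        obtain d where d: "v = u + d" using le_Suc_ex[OF uv(1)] by blast
        obtain e where "k = 2 * v + e" using le_Suc_ex[OF uv(2)] by blast
        then have "k - u = u + 2 * d + e" "k - v = u + d + e" using d by simp_all
        then show ?thesis unfolding d by (simp add: algebra_simps)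
      qed
      from this[OF ij(3) le] have "i * (k - i) \<le> j * (k - j)"
        using minmax[of i] minmax[of j] ij(1,2) by simp
      then show "0 \<le> M j" if "0 < M i"
        using turan_term_sign[OF \<open>0 < \<mu>\<close> ab, of i "k - i" j "k - j"] that ij(1,2) by (simp add: M_def)
    qed simp
    also have "\<dots> = G \<mu> + (\<Sum>j\<le>k. w j * turan_term \<mu> a b (k - j) j)"
      by (simp add: M_def G_def distrib_left sum.distrib)
    also have "(\<Sum>j\<le>k. w j * turan_term \<mu> a b (k - j) j) = G \<mu>"
      unfolding G_def by (subst sum_reflect[symmetric]) (simp add: sym)
    finally show ?thesis by simp
  qed
  show ?thesis
  proof (cases "\<mu> = 0")
    case True
    \<comment> \<open>At \<mu> = 0 the Raney numbers of positive index vanish and the sign transfer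
      breaks down, so the inequality is taken as a limit from the right.\<close>
    have "isCont G 0"
      unfolding G_def turan_term_def
      using isCont_raney[of 0 0] isCont_raney[of 0 a] isCont_raney[of 0 b] isCont_raney[of 0 "a + b"]
      by (intro continuous_intros) (simp_all add: add.assoc)
    then have "(G \<longlongrightarrow> G 0) (at_right 0)"
      by (simp add: isCont_def filterlim_at_split)
    moreover have "eventually (\<lambda>\<mu>. 0 \<le> G \<mu>) (at_right 0)"
      using pos by (auto simp: eventually_at_filter)
    ultimately have "0 \<le> G 0"
      by (rule tendsto_lowerbound) simp
    then show ?thesis using True by (simp add: G_def)
  next
    case False
    then show ?thesis using pos[of \<mu>] assms(1) by (simp add: G_def)
  qed
qed

lemma turanian_fps_hseries_nth:
  "fps_nth (turanian_fps (hseries h) \<mu> (real a) (real b)) k =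
     (\<Sum>j\<le>k. (h j * h (k - j)) * turan_term \<mu> a b j (k - j))"
  by (simp add: turanian_fps_def fps_mult_nth hseries_nth turan_term_def atMost_atLeast0
      sum_subtractf[symmetric] algebra_simps)

lemma turanian_fps_commute: "turanian_fps F \<mu> \<alpha> \<beta> = turanian_fps F \<mu> \<beta> \<alpha>"
  by (simp add: turanian_fps_def add_ac mult.commute)

text \<open>The exchange inequality \<open>step\<close> says that \<open>h j * h (k - j)\<close>
  grows towards the middle. Symmetry of the Turanian in its shifts reduces to
  \<open>a \<le> b\<close>.\<close>

lemma turanian_fps_hseries_nonneg:
  assumes "0 \<le> \<mu>" "1 \<le> a" "1 \<le> b" "a + b \<le> 4"
    and step: "\<And>i l. i \<le> l \<Longrightarrow> h i * h (Suc l) \<le> h (Suc i) * h l"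
  shows "0 \<le> fps_nth (turanian_fps (hseries h) \<mu> (real a) (real b)) k"
proof -
  have "0 \<le> fps_nth (turanian_fps (hseries h) \<mu> (real a) (real b)) k"
    if "1 \<le> a" "a \<le> b" "a + b \<le> 4" for a b
    unfolding turanian_fps_hseries_nth
  proof (rule sum_weighted_turan_term_nonneg[OF assms(1) that])
    show "h j * h (k - j) \<le> h (Suc j) * h (k - Suc j)" if "2 * j < k" for j
      \<comment> \<open>The condition \<open>2 * j < k\<close> is exactly
        \<open>j \<le> k - Suc j\<close>.\<close>
      using step[of j "k - Suc j"] that by (simp add: Suc_diff_Suc)
  qed simp
  from this[of a b] this[of b a] show ?thesis
    using assms(2-4) turanian_fps_commute[of "hseries h" \<mu> "real a" "real b"] by (cases "a \<le> b") auto
qed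

lemma turanian_fps_hseries_nonpos:
  assumes "0 \<le> \<mu>" "1 \<le> a" "1 \<le> b" "a + b \<le> 4"
    and step: "\<And>i l. i \<le> l \<Longrightarrow> h (Suc i) * h l \<le> h i * h (Suc l)"
  shows "fps_nth (turanian_fps (hseries h) \<mu> (real a) (real b)) k \<le> 0"
proof -
  have "fps_nth (turanian_fps (hseries h) \<mu> (real a) (real b)) k \<le> 0"
    if "1 \<le> a" "a \<le> b" "a + b \<le> 4" for a b
  proof -
    \<comment> \<open>The weights now fall towards the middle, so their negatives rise.\<close>
    have "0 \<le> (\<Sum>j\<le>k. - (h j * h (k - j)) * turan_term \<mu> a b j (k - j))"
    proof (rule sum_weighted_turan_term_nonneg[OF assms(1) that])
      show "- (h j * h (k - j)) \<le> - (h (Suc j) * h (k - Suc j))" if "2 * j < k" for j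
        using step[of j "k - Suc j"] that by (simp add: Suc_diff_Suc)
    qed simp
    then show ?thesis
      by (simp add: turanian_fps_hseries_nth sum_negf)
  qed
  from this[of a b] this[of b a] show ?thesis
    using assms(2-4) turanian_fps_commute[of "hseries h" \<mu> "real a" "real b"] by (cases "a \<le> b") auto
qed

section \<open>Exchange inequalities for log-concave and log-convex sequences\<close>

text \<open>Successive ratios decrease, by induction on \<open>l\<close>. The bound \<open>N\<close>
  allows application to function values known to be finite only up to some shift.\<close>

lemma log_concave_exchange:
  fixes h :: "nat \<Rightarrow> real"
  assumes nonneg: "\<And>n. n \<le> N \<Longrightarrow> 0 \<le> h n"
    and concave: "\<And>n. n + 2 \<le> N \<Longrightarrow> h n * h (n + 2) \<le> (h (n + 1))\<^sup>2"
    and zeros: "\<And>i j l. \<lbrakk>i \<le> j; j \<le> l; l \<le> N; h i \<noteq> 0; h l \<noteq> 0\<rbrakk> \<Longrightarrow> h j \<noteq> 0"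
    and "i \<le> l" "Suc l \<le> N"
  shows "h i * h (Suc l) \<le> h (Suc i) * h l"
  using assms(4,5)
proof (induction rule: dec_induct)
  case base
  show ?case by (simp add: mult.commute)
next
  case (step l)
  show ?case
  \<comment> \<open>A zero end value makes the left-hand side 0; otherwise \<open>h l\<close> is
    positive, having no internal zero, and can be cancelled.\<close>
  proof (cases "h i = 0 \<or> h (l + 2) = 0")
    case True
    then show ?thesis using step nonneg[of "Suc i"] nonneg[of "Suc l"] by auto
  next
    case False
    then have "h l \<noteq> 0"
      using zeros[of i l "l + 2"] step by simp
    then have pos: "0 < h l" using nonneg[of l] step by simp
    have "h l * (h i * h (l + 2)) = h i * (h l * h (l + 2))" by simp
    also have "\<dots> \<le> h i * (h (l + 1))\<^sup>2"
      using concave[of l] nonneg[of i] step by (intro mult_left_mono) auto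
    also have "\<dots> = (h i * h (Suc l)) * h (Suc l)" by (simp add: power2_eq_square)
    also have "\<dots> \<le> (h (Suc i) * h l) * h (Suc l)"
      using step nonneg[of "Suc l"] by (intro mult_right_mono) auto
    also have "\<dots> = h l * (h (Suc i) * h (Suc l))" by simp
    finally show ?thesis using pos by simp
  qed
qed

lemma log_convex_exchange:
  fixes h :: "nat \<Rightarrow> real"
  assumes nonneg: "\<And>n. n \<le> N \<Longrightarrow> 0 \<le> h n"
    and convex: "\<And>n. n + 2 \<le> N \<Longrightarrow> (h (n + 1))\<^sup>2 \<le> h n * h (n + 2)"
    and "i \<le> l" "Suc l \<le> N"
  shows "h (Suc i) * h l \<le> h i * h (Suc l)"
  using assms(3,4)
proof (induction rule: dec_induct)
  case base
  show ?case by (simp add: mult.commute)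
next
  case (step l)
  show ?case
  proof (cases "h l = 0")
    case True
    \<comment> \<open>Log-convexity bounds the square of \<open>h (Suc l)\<close> by a multiple of
      \<open>h l\<close>, so the zero propagates upwards.\<close>
    then have "h (Suc l) = 0" using convex[of l] step by simp
    then show ?thesis using step nonneg[of i] nonneg[of "Suc (Suc l)"] by simp
  next
    case False
    then have pos: "0 < h l" using nonneg[of l] step by simp
    have "h l * (h (Suc i) * h (Suc l)) = (h (Suc i) * h l) * h (Suc l)" by simp
    also have "\<dots> \<le> (h i * h (Suc l)) * h (Suc l)"
      using step nonneg[of "Suc l"] by (intro mult_right_mono) auto
    also have "\<dots> = h i * (h (l + 1))\<^sup>2" by (simp add: power2_eq_square)
    also have "\<dots> \<le> h i * (h l * h (l + 2))"
      using convex[of l] nonneg[of i] step by (intro mult_left_mono) auto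
    also have "\<dots> = h l * (h i * h (Suc (Suc l)))" by simp
    finally show ?thesis using pos by simp
  qed
qed

text \<open>Moves from the pair (0, a + b) to (a, b) by unit exchanges. A general \<open>g\<close>
  covers products as well as negated products.\<close>

lemma exchange_mono:
  fixes g :: "nat \<Rightarrow> nat \<Rightarrow> real"
  assumes step: "\<And>i l. \<lbrakk>i \<le> l; i + Suc l = a + b\<rbrakk> \<Longrightarrow> g i (Suc l) \<le> g (Suc i) l"
    and "a \<le> b"
  shows "g 0 (a + b) \<le> g a b"
proof -
  have "g 0 (a + b) \<le> g i (a + b - i)" if "i \<le> a" for i
    using that
  proof (induction i)
    case (Suc i)
    then show ?case
      using step[of i "a + b - Suc i"] \<open>a \<le> b\<close> by (simp add: Suc_diff_Suc)
  qed simp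
  from this[of a] show ?thesis by simp
qed

section \<open>From coefficients to values\<close>

text \<open>Non-negative coefficients and \<open>0 \<le> x\<close> make the convergence absolute, so
  Cauchy products represent the products of values.\<close>

lemma eval_fps_turanian_sums:
  fixes F :: "real \<Rightarrow> real fps"
  assumes nonneg: "\<And>\<nu> k. \<nu> \<in> S \<Longrightarrow> 0 \<le> fps_nth (F \<nu>) k"
    and conv: "\<And>\<nu>. \<nu> \<in> S \<Longrightarrow> converges_at (F \<nu>) x"
    and S: "S = {\<mu>, \<mu> + \<alpha>, \<mu> + \<beta>, \<mu> + \<alpha> + \<beta>}" and "0 \<le> x"
  shows "(\<lambda>k. fps_nth (turanian_fps F \<mu> \<alpha> \<beta>) k * x ^ k) sums turanian F \<mu> \<alpha> \<beta> x"
proof -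
  have prod: "(\<lambda>k. fps_nth (F \<nu> * F \<nu>') k * x ^ k) sums (eval_fps (F \<nu>) x * eval_fps (F \<nu>') x)"
    if "\<nu> \<in> S" "\<nu>' \<in> S" for \<nu> \<nu>'
  proof -
    have abs: "summable (\<lambda>k. norm (fps_nth (F \<nu>) k * x ^ k))" if "\<nu> \<in> S" for \<nu>
      using conv[OF that] nonneg[OF that] \<open>0 \<le> x\<close> by (simp add: converges_at_def abs_mult)
    have "(\<Sum>i\<le>k. fps_nth (F \<nu>) i * x ^ i * (fps_nth (F \<nu>') (k - i) * x ^ (k - i))) =
        fps_nth (F \<nu> * F \<nu>') k * x ^ k" for k
      unfolding fps_mult_nth sum_distrib_right atMost_atLeast0
    proof (rule sum.cong)
      fix i assume "i \<in> {0..k}"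
      then have "x ^ k = x ^ i * x ^ (k - i)" by (simp flip: power_add)
      then show "fps_nth (F \<nu>) i * x ^ i * (fps_nth (F \<nu>') (k - i) * x ^ (k - i)) =
        fps_nth (F \<nu>) i * fps_nth (F \<nu>') (k - i) * x ^ k" by simp
    qed simp
    with Cauchy_product_sums[OF abs[OF that(1)] abs[OF that(2)]] show ?thesis
      by (simp add: eval_fps_def)
  qed
  show ?thesis
    unfolding turanian_fps_def turanian_def fps_sub_nth left_diff_distrib
    by (intro sums_diff prod) (auto simp: S)
qed

text \<open>By monotonicity of the Raney numbers, the series at the largest parameter dominates the
  others term by term.\<close>

lemma
  assumes h: "\<And>k. 0 \<le> h k" and "0 \<le> \<mu>" "0 \<le> x"
    and conv: "converges_at (hseries h (\<mu> + real N)) x" and "n \<le> N"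
  shows converges_at_hseries_smaller: "converges_at (hseries h (\<mu> + real n)) x"
    and eval_hseries_mono: "eval_fps (hseries h (\<mu> + real n)) x \<le> eval_fps (hseries h (\<mu> + real N)) x"
    and eval_hseries_nonneg: "0 \<le> eval_fps (hseries h (\<mu> + real n)) x"
proof -
  have le: "fps_nth (hseries h (\<mu> + real n)) k * x ^ k \<le> fps_nth (hseries h (\<mu> + real N)) k * x ^ k" for k
    using assms by (simp add: hseries_nth mult_left_mono mult_right_mono raney_mono_nat)
  have nonneg: "0 \<le> fps_nth (hseries h (\<mu> + real n)) k * x ^ k" for k
    using assms by (simp add: hseries_nth raney_nonneg)
  show c: "converges_at (hseries h (\<mu> + real n)) x"
    unfolding converges_at_def
    by (rule summable_comparison_test'[OF conv[unfolded converges_at_def], where N = 0])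
      (use le nonneg in auto)
  show "eval_fps (hseries h (\<mu> + real n)) x \<le> eval_fps (hseries h (\<mu> + real N)) x"
    using c conv le by (auto simp: eval_fps_def converges_at_def intro: suminf_le)
  show "0 \<le> eval_fps (hseries h (\<mu> + real n)) x"
    using c nonneg by (auto simp: eval_fps_def converges_at_def intro: suminf_nonneg)
qed

lemma turanian_1_1_sums:
  assumes "\<And>k. 0 \<le> h k" "0 \<le> \<mu>" "0 \<le> x"
    and "converges_at (hseries h (\<mu> + real N)) x" "n + 2 \<le> N"
  shows "(\<lambda>k. fps_nth (turanian_fps (hseries h) (\<mu> + real n) 1 1) k * x ^ k) sums
     ((eval_fps (hseries h (\<mu> + real (n + 1))) x)\<^sup>2
       - eval_fps (hseries h (\<mu> + real n)) x * eval_fps (hseries h (\<mu> + real (n + 2))) x)"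
proof -
  have m: "converges_at (hseries h (\<mu> + real m)) x" if "m \<le> N" for m
    using converges_at_hseries_smaller assms that by blast
  have "(\<lambda>k. fps_nth (turanian_fps (hseries h) (\<mu> + real n) 1 1) k * x ^ k) sums
      turanian (hseries h) (\<mu> + real n) 1 1 x"
  proof (rule eval_fps_turanian_sums[OF _ _ refl])
    show "0 \<le> fps_nth (hseries h \<nu>) k"
      if "\<nu> \<in> {\<mu> + real n, \<mu> + real n + 1, \<mu> + real n + 1, \<mu> + real n + 1 + 1}" for \<nu> k
      using that assms(1,2) by (auto simp: hseries_nth raney_nonneg)
    show "converges_at (hseries h \<nu>) x"
      if "\<nu> \<in> {\<mu> + real n, \<mu> + real n + 1, \<mu> + real n + 1, \<mu> + real n + 1 + 1}" for \<nu>
      using that m[of n] m[of "n + 1"] m[of "n + 2"] assms(5) by (auto simp: add_ac)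
  qed (rule assms(3))
  then show ?thesis
    by (simp add: turanian_def power2_eq_square add_ac)
qed

text \<open>Unit shifts show that \<open>A\<close> is log-concave up to index \<open>a + b\<close>;
  exchanging units then compares (0, a + b) with (a, b).\<close>

lemma turanian_nonneg:
  assumes h: "\<And>k. 0 \<le> h k" and "0 \<le> \<mu>" "0 \<le> x"
    and conv: "converges_at (hseries h (\<mu> + real a + real b)) x"
    and step: "\<And>i l. i \<le> l \<Longrightarrow> h i * h (Suc l) \<le> h (Suc i) * h l"
  shows "0 \<le> turanian (hseries h) \<mu> (real a) (real b) x"
proof -
  define A where "A n = eval_fps (hseries h (\<mu> + real n)) x" for n
  have conv': "converges_at (hseries h (\<mu> + real (a + b))) x"
    using conv by (simp add: add.assoc)
  note hs = h \<open>0 \<le> \<mu>\<close> \<open>0 \<le> x\<close>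
  have nonneg: "0 \<le> A n" if "n \<le> a + b" for n
    unfolding A_def using eval_hseries_nonneg[OF hs conv' that] .
  have mono: "A i \<le> A j" if "i \<le> j" "j \<le> a + b" for i j
    unfolding A_def
    using eval_hseries_mono[OF hs converges_at_hseries_smaller[OF hs conv' that(2)] that(1)] .
  have concave: "A n * A (n + 2) \<le> (A (n + 1))\<^sup>2" if "n + 2 \<le> a + b" for n
  proof -
    have "0 \<le> (A (n + 1))\<^sup>2 - A n * A (n + 2)"
      unfolding A_def
      using turanian_fps_hseries_nonneg[of "\<mu> + real n" 1 1 h, OF _ _ _ _ step] hs
      by (intro sums_le[OF _ sums_zero turanian_1_1_sums[OF hs conv' that]]) simp
    then show ?thesis by simp
  qed
  have ex: "A i * A (Suc l) \<le> A (Suc i) * A l" if "i \<le> l" "Suc l \<le> a + b" for i l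
  proof (rule log_concave_exchange[OF nonneg concave _ that])
    \<comment> \<open>\<open>A\<close> is non-decreasing, so a nonzero value is never followed by a
      zero.\<close>
    fix i j l assume "i \<le> j" "j \<le> l" "l \<le> a + b" "A i \<noteq> 0"
    then show "A j \<noteq> 0" using nonneg[of i] mono[of i j] by auto
  qed
  \<comment> \<open>\<open>exchange_mono\<close> expects the smaller shift first, hence the two
    instances.\<close>
  have "A 0 * A (a + b) \<le> A a * A b"
    using exchange_mono[of a b "\<lambda>i l. A i * A l"] exchange_mono[of b a "\<lambda>i l. A i * A l"] ex
    by (cases "a \<le> b") (auto simp: add.commute mult.commute)
  then show ?thesis by (simp add: A_def turanian_def add.assoc)
qed

lemma turanian_nonpos:
  assumes h: "\<And>k. 0 \<le> h k" and "0 \<le> \<mu>" "0 \<le> x"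
    and conv: "converges_at (hseries h (\<mu> + real a + real b)) x"
    and step: "\<And>i l. i \<le> l \<Longrightarrow> h (Suc i) * h l \<le> h i * h (Suc l)"
  shows "turanian (hseries h) \<mu> (real a) (real b) x \<le> 0"
proof -
  define A where "A n = eval_fps (hseries h (\<mu> + real n)) x" for n
  have conv': "converges_at (hseries h (\<mu> + real (a + b))) x"
    using conv by (simp add: add.assoc)
  note hs = h \<open>0 \<le> \<mu>\<close> \<open>0 \<le> x\<close>
  have nonneg: "0 \<le> A n" if "n \<le> a + b" for n
    unfolding A_def using eval_hseries_nonneg[OF hs conv' that] .
  have convex: "(A (n + 1))\<^sup>2 \<le> A n * A (n + 2)" if "n + 2 \<le> a + b" for n
  proof -
    have "(A (n + 1))\<^sup>2 - A n * A (n + 2) \<le> 0"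
      unfolding A_def
      using turanian_fps_hseries_nonpos[of "\<mu> + real n" 1 1 h, OF _ _ _ _ step] hs
      by (intro sums_le[OF _ turanian_1_1_sums[OF hs conv' that] sums_zero])
        (simp add: mult_nonpos_nonneg)
    then show ?thesis by simp
  qed
  note ex = log_convex_exchange[OF nonneg convex]
  have "A a * A b \<le> A 0 * A (a + b)"
    \<comment> \<open>Negating the products gives the reversed exchange inequality the direction
      required by \<open>exchange_mono\<close>.\<close>
    using exchange_mono[of a b "\<lambda>i l. - (A i * A l)"] exchange_mono[of b a "\<lambda>i l. - (A i * A l)"] ex
    by (cases "a \<le> b") (auto simp: add.commute mult.commute)
  then show ?thesis by (simp add: A_def turanian_def add.assoc)
qed

lemma log_concave_seq_exchange:
  assumes "log_concave_seq h" "i \<le> l"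
  shows "h i * h (Suc l) \<le> h (Suc i) * h l"
proof (rule log_concave_exchange[where N = "Suc l"])
  show "h n * h (n + 2) \<le> (h (n + 1))\<^sup>2" for n
    using assms(1) by (auto simp: log_concave_seq_def dest!: spec[of _ "n + 1"])
  show "0 \<le> h n" for n
    using assms(1) by (simp add: log_concave_seq_def nonneg_nontrivial_def)
  have "no_internal_zeros h"
    using assms(1) by (simp add: log_concave_seq_def)
  then show "h j \<noteq> 0" if "i \<le> j" "j \<le> l" "h i \<noteq> 0" "h l \<noteq> 0" for i j l
    unfolding no_internal_zeros_def using that by blast
qed (use assms in simp_all)

lemma log_convex_seq_exchange:
  assumes "log_convex_seq h" "i \<le> l"
  shows "h (Suc i) * h l \<le> h i * h (Suc l)"
proof (rule log_convex_exchange[where N = "Suc l"])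
  show "(h (n + 1))\<^sup>2 \<le> h n * h (n + 2)" for n
    using assms(1) by (auto simp: log_convex_seq_def dest!: spec[of _ "n + 1"])
  show "0 \<le> h n" for n
    using assms(1) by (simp add: log_convex_seq_def nonneg_nontrivial_def)
qed (use assms in simp_all)

theorem theorem4p3:
  fixes h :: "nat \<Rightarrow> real"
  shows
    "(log_concave_seq h \<longrightarrow>
        log_concave_for_shifts (hseries h)
          {(real a, real b) | a b. 1 \<le> a \<and> 1 \<le> b} \<and>
        coeffwise_log_concave_for_shifts (hseries h)
          {(real a, real b) | a b. 1 \<le> a \<and> 1 \<le> b \<and> a + b \<le> 4}) \<and>
     (log_convex_seq h \<longrightarrow>
        log_convex_for_shifts (hseries h)
          {(real a, real b) | a b. 1 \<le> a \<and> 1 \<le> b} \<and>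
        coeffwise_log_convex_for_shifts (hseries h)
          {(real a, real b) | a b. 1 \<le> a \<and> 1 \<le> b \<and> a + b \<le> 4})"
proof (intro conjI impI)
  assume h: "log_concave_seq h"
  then have nonneg: "0 \<le> h k" for k
    by (simp add: log_concave_seq_def nonneg_nontrivial_def)
  show "log_concave_for_shifts (hseries h) {(real a, real b) | a b. 1 \<le> a \<and> 1 \<le> b}"
    unfolding log_concave_for_shifts_def
    using turanian_nonneg[OF nonneg] log_concave_seq_exchange[OF h] by auto
  show "coeffwise_log_concave_for_shifts (hseries h)
      {(real a, real b) | a b. 1 \<le> a \<and> 1 \<le> b \<and> a + b \<le> 4}"
    unfolding coeffwise_log_concave_for_shifts_def
    using turanian_fps_hseries_nonneg log_concave_seq_exchange[OF h] by auto
next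
  assume h: "log_convex_seq h"
  then have nonneg: "0 \<le> h k" for k
    by (simp add: log_convex_seq_def nonneg_nontrivial_def)
  show "log_convex_for_shifts (hseries h) {(real a, real b) | a b. 1 \<le> a \<and> 1 \<le> b}"
    unfolding log_convex_for_shifts_def
    using turanian_nonpos[OF nonneg] log_convex_seq_exchange[OF h] by auto
  show "coeffwise_log_convex_for_shifts (hseries h)
      {(real a, real b) | a b. 1 \<le> a \<and> 1 \<le> b \<and> a + b \<le> 4}"
    unfolding coeffwise_log_convex_for_shifts_def
    using turanian_fps_hseries_nonpos log_convex_seq_exchange[OF h] by auto
qed

end
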